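(* Let $F$ and $H$ be $r$-regular non-isomorphic cospectral graphs. Then for every graph $G$: (a) $G\veebar F$ and $G\veebar H$ are $\{A,Q,L\}$NICS; (b) $G\underset{=}{\vee}F$ and $G\underset{=}{\vee}H$ are $\{A,Q,L\}$NICS.
   Context: Graphs are finite, undirected and simple. $A(G)$ is the adjacency matrix, $D(G)$ the diagonal matrix of vertex degrees, $L(G)=D(G)-A(G)$ the Laplacian, $Q(G)=D(G)+A(G)$ the signless Laplacian. For $X\in\{A,L,Q\}$ the $X$-spectrum of $G$ is the multiset of eigenvalues of $X(G)$; two graphs are $X$-cospectral if they have the same $X$-spectrum. For a set $S$ of such matrix types, two graphs are $S$NICS if they are non-isomorphic and $X$-cospectral for every $X\in S$. Two regular graphs are called cospectral if they have the same adjacency spectrum (for regular graphs this is equivalent to being $L$-cospectral or $Q$-cospectral). For vertex-disjoint graphs $G_1$ (with $V(G_1)=\{u_1,\dots,u_{n}\}$) and $G_2$, the join $G_1\vee G_2$ is the disjoint union together with all edges between $V(G_1)$ and $V(G_2)$. The NS (Neighbors Splitting) join $G_1\veebar G_2$ is obtained from $G_1\vee G_2$ by adding new vertices $u_1',\dots,u_{n}'$ and joining $u_i'$ to $u_j$ if and only if $u_iu_j\in E(G_1)$. The NNS (Non Neighbors Splitting) join $G_1\underset{=}{\vee}G_2$ is obtained from $G_1\vee G_2$ by adding new vertices $u_1',\dots,u_{n}'$ and joining $u_i'$ to $u_j$ if and only if $i\ne j$ and $u_iu_j\notin E(G_1)$. *)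

theory Defs
  imports
    "HOL-Computational_Algebra.Polynomial"
    "Jordan_Normal_Form.Char_Poly"
    "Graph_Theory.Graph_Theory"
begin

text \<open>
  A finite simple undirected graph is a \<^locale>\<open>pair_graph\<close>: finitely many vertices, no loops, and a
  symmetric set of arcs, an edge \<open>uv\<close> being the two arcs \<open>(u, v)\<close> and \<open>(v, u)\<close>.
\<close>

definition graph_iso :: "'a pair_pre_digraph \<Rightarrow> 'b pair_pre_digraph \<Rightarrow> bool" where
  "graph_iso G H \<longleftrightarrow> digraph_iso (with_proj G) (with_proj H)"

text \<open>Since the arcs are symmetric, the out-degree is the degree.\<close>

definition regular :: "nat \<Rightarrow> 'a pair_pre_digraph \<Rightarrow> bool" where
  "regular r G \<longleftrightarrow> (\<forall>v\<in>pverts G. out_degree (with_proj G) v = r)"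


section \<open>Matrices and spectra of a graph\<close>

datatype matrix_type = Adjacency | Laplacian | Signless_Laplacian

context
  fixes vs :: "'a list" and G :: "'a pair_pre_digraph"
begin

text \<open>The list \<open>vs\<close> enumerates the vertices; entry \<open>(i, j)\<close> belongs to \<open>vs ! i\<close> and \<open>vs ! j\<close>.\<close>

definition adjacency_matrix :: "complex mat" where
  "adjacency_matrix = mat (length vs) (length vs) (\<lambda>(i, j). if (vs ! i, vs ! j) \<in> parcs G then 1 else 0)"

definition degree_matrix :: "complex mat" where
  "degree_matrix = mat (length vs) (length vs)
     (\<lambda>(i, j). if i = j then of_nat (out_degree (with_proj G) (vs ! i)) else 0)"

fun graph_matrix :: "matrix_type \<Rightarrow> complex mat" where
  "graph_matrix Adjacency = adjacency_matrix"
| "graph_matrix Laplacian = degree_matrix - adjacency_matrix"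
| "graph_matrix Signless_Laplacian = degree_matrix + adjacency_matrix"

end

definition vertex_enum :: "'a pair_pre_digraph \<Rightarrow> 'a list" where
  "vertex_enum G = (SOME vs. distinct vs \<and> set vs = pverts G)"

text \<open>
  The eigenvalues with their multiplicities as roots of the characteristic polynomial. They do not
  depend on the enumeration of the vertices that is chosen, see \<open>graph_spectrum_enum\<close> below. All of
  them are real, the matrices being real symmetric.
\<close>

definition graph_spectrum :: "matrix_type \<Rightarrow> 'a pair_pre_digraph \<Rightarrow> complex multiset" where
  "graph_spectrum X G = proots (char_poly (graph_matrix (vertex_enum G) G X))"

definition cospectral :: "matrix_type \<Rightarrow> 'a pair_pre_digraph \<Rightarrow> 'b pair_pre_digraph \<Rightarrow> bool" where
  "cospectral X G H \<longleftrightarrow> graph_spectrum X G = graph_spectrum X H"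

definition NICS :: "matrix_type set \<Rightarrow> 'a pair_pre_digraph \<Rightarrow> 'b pair_pre_digraph \<Rightarrow> bool" where
  "NICS S G H \<longleftrightarrow> \<not> graph_iso G H \<and> (\<forall>X\<in>S. cospectral X G H)"


section \<open>The joins\<close>

text \<open>
  The constructors make the vertex sets disjoint: \<open>Fst u\<close> and \<open>Snd x\<close> are the vertices of the two
  graphs, and \<open>Copy u\<close> is the new vertex \<open>u'\<close>.
\<close>

datatype ('a, 'b) join_vertex = Fst 'a | Snd 'b | Copy 'a

definition join :: "'a pair_pre_digraph \<Rightarrow> 'b pair_pre_digraph \<Rightarrow> ('a, 'b) join_vertex pair_pre_digraph" where
  "join G1 G2 = \<lparr>
     pverts = Fst ` pverts G1 \<union> Snd ` pverts G2,
     parcs = map_prod Fst Fst ` parcs G1 \<union> map_prod Snd Snd ` parcs G2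
       \<union> Fst ` pverts G1 \<times> Snd ` pverts G2 \<union> Snd ` pverts G2 \<times> Fst ` pverts G1 \<rparr>"

text \<open>For \<open>(u, w) \<in> R\<close> the new vertex \<open>u'\<close> is joined to \<open>w\<close>, by arcs in both directions.\<close>

definition splitting_join ::
  "'a rel \<Rightarrow> 'a pair_pre_digraph \<Rightarrow> 'b pair_pre_digraph \<Rightarrow> ('a, 'b) join_vertex pair_pre_digraph" where
  "splitting_join R G1 G2 = \<lparr>
     pverts = pverts (join G1 G2) \<union> Copy ` pverts G1,
     parcs = parcs (join G1 G2) \<union> map_prod Copy Fst ` R \<union> (map_prod Copy Fst ` R)\<inverse> \<rparr>"

definition NS_join :: "'a pair_pre_digraph \<Rightarrow> 'b pair_pre_digraph \<Rightarrow> ('a, 'b) join_vertex pair_pre_digraph" where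
  "NS_join G1 G2 = splitting_join (parcs G1) G1 G2"

definition NNS_join :: "'a pair_pre_digraph \<Rightarrow> 'b pair_pre_digraph \<Rightarrow> ('a, 'b) join_vertex pair_pre_digraph" where
  "NNS_join G1 G2 =
     splitting_join {(u, w). u \<in> pverts G1 \<and> w \<in> pverts G1 \<and> u \<noteq> w \<and> (u, w) \<notin> parcs G1} G1 G2"


section \<open>Well-definedness\<close>

lemma vertex_enum:
  assumes "pair_graph G"
  shows "distinct (vertex_enum G)" "set (vertex_enum G) = pverts G"
proof -
  interpret pair_graph G by fact
  have "\<exists>vs. distinct vs \<and> set vs = pverts G"
    using finite_distinct_list[OF pair_finite_verts] by blast
  then have "distinct (vertex_enum G) \<and> set (vertex_enum G) = pverts G"
    unfolding vertex_enum_def by (rule someI_ex)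
  then show "distinct (vertex_enum G)" "set (vertex_enum G) = pverts G" by auto
qed

lemma mat_reindex_similar:
  fixes f :: "'a \<Rightarrow> 'a \<Rightarrow> 'b :: field"
  assumes "distinct xs" "distinct ys" "set xs = set ys"
  shows "similar_mat (mat (length xs) (length xs) (\<lambda>(i, j). f (xs ! i) (xs ! j)))
                     (mat (length ys) (length ys) (\<lambda>(i, j). f (ys ! i) (ys ! j)))"
proof -
  define n where "n = length xs"
  have ny: "length ys = n"
    using assms by (metis distinct_card n_def)
  define P :: "'b mat" where "P = mat n n (\<lambda>(i, j). if xs ! i = ys ! j then 1 else 0)"
  define Q :: "'b mat" where "Q = mat n n (\<lambda>(i, j). if ys ! i = xs ! j then 1 else 0)"
  define B where "B = mat n n (\<lambda>(i, j). f (ys ! i) (ys ! j))"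
  have bij: "bij_betw ((!) zs) {0..<n} (set xs)" if "zs = xs \<or> zs = ys" for zs
    using that
  proof
    show ?thesis if "zs = xs"
      unfolding that by (rule bij_betw_nth[OF assms(1)]) (auto simp: n_def)
    show ?thesis if "zs = ys"
      unfolding that by (rule bij_betw_nth[OF assms(2)]) (use ny assms(3) in auto)
  qed
  have sumx: "(\<Sum>k = 0..<n. g (zs ! k)) = (\<Sum>z\<in>set xs. g z)" if "zs = xs \<or> zs = ys"
    for zs and g :: "'a \<Rightarrow> 'b"
    using sum.reindex_bij_betw[OF bij[OF that]] .
  have inx: "xs ! i \<in> set xs" "ys ! i \<in> set xs" if "i < n" for i
  proof -
    show "xs ! i \<in> set xs" using that by (simp add: n_def)
    show "ys ! i \<in> set xs" unfolding assms(3) using that by (simp add: ny)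
  qed
  have eqx: "xs ! i = xs ! j \<longleftrightarrow> i = j" "ys ! i = ys ! j \<longleftrightarrow> i = j" if "i < n" "j < n" for i j
    using that nth_eq_iff_index_eq[OF assms(1)] nth_eq_iff_index_eq[OF assms(2)]
    by (simp_all add: n_def[symmetric] ny)
  have PQ: "P * Q = 1\<^sub>m n"
  proof (rule eq_matI)
    fix i j assume "i < dim_row (1\<^sub>m n :: 'b mat)" "j < dim_col (1\<^sub>m n :: 'b mat)"
    then have ij: "i < n" "j < n" by auto
    have "(P * Q) $$ (i, j)
        = (\<Sum>k = 0..<n. (if xs ! i = ys ! k then 1 else 0) * (if ys ! k = xs ! j then 1 else 0))"
      using ij by (simp add: P_def Q_def scalar_prod_def)
    also have "\<dots> = (\<Sum>z\<in>set xs. (if xs ! i = z then 1 else 0) * (if z = xs ! j then 1 else 0))"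
      using sumx[of ys "\<lambda>z. (if xs ! i = z then 1 else 0) * (if z = xs ! j then 1 else 0)"] by simp
    also have "\<dots> = (\<Sum>z\<in>set xs. if xs ! i = z then (if z = xs ! j then 1 else 0) else 0)"
      by (rule sum.cong) auto
    also have "\<dots> = 1\<^sub>m n $$ (i, j)"
      using ij inx eqx by simp
    finally show "(P * Q) $$ (i, j) = 1\<^sub>m n $$ (i, j)" .
  qed (auto simp: P_def Q_def)
  have QP: "Q * P = 1\<^sub>m n"
    by (rule mat_mult_left_right_inverse[where A = P and B = Q and n = n]) (use PQ in \<open>auto simp: P_def Q_def\<close>)
  have PB: "P * B = mat n n (\<lambda>(i, j). f (xs ! i) (ys ! j))"
  proof (rule eq_matI)
    fix i j assume "i < dim_row (mat n n (\<lambda>(i, j). f (xs ! i) (ys ! j)))"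
      "j < dim_col (mat n n (\<lambda>(i, j). f (xs ! i) (ys ! j)))"
    then have ij: "i < n" "j < n" by auto
    have "(P * B) $$ (i, j) = (\<Sum>k = 0..<n. (if xs ! i = ys ! k then 1 else 0) * f (ys ! k) (ys ! j))"
      using ij by (simp add: P_def B_def scalar_prod_def)
    also have "\<dots> = (\<Sum>z\<in>set xs. (if xs ! i = z then 1 else 0) * f z (ys ! j))"
      using sumx[of ys "\<lambda>z. (if xs ! i = z then 1 else 0) * f z (ys ! j)"] by simp
    also have "\<dots> = (\<Sum>z\<in>set xs. if xs ! i = z then f z (ys ! j) else 0)"
      by (rule sum.cong) auto
    finally show "(P * B) $$ (i, j) = mat n n (\<lambda>(i, j). f (xs ! i) (ys ! j)) $$ (i, j)"
      using ij inx by simp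
  qed (auto simp: P_def B_def)
  have PBQ: "P * B * Q = mat n n (\<lambda>(i, j). f (xs ! i) (xs ! j))"
  proof (rule eq_matI)
    fix i j assume "i < dim_row (mat n n (\<lambda>(i, j). f (xs ! i) (xs ! j)))"
      "j < dim_col (mat n n (\<lambda>(i, j). f (xs ! i) (xs ! j)))"
    then have ij: "i < n" "j < n" by auto
    have "(P * B * Q) $$ (i, j) = (\<Sum>k = 0..<n. f (xs ! i) (ys ! k) * (if ys ! k = xs ! j then 1 else 0))"
      unfolding PB using ij by (simp add: Q_def scalar_prod_def)
    also have "\<dots> = (\<Sum>z\<in>set xs. f (xs ! i) z * (if z = xs ! j then 1 else 0))"
      using sumx[of ys "\<lambda>z. f (xs ! i) z * (if z = xs ! j then 1 else 0)"] by simp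
    also have "\<dots> = (\<Sum>z\<in>set xs. if z = xs ! j then f (xs ! i) z else 0)"
      by (rule sum.cong) auto
    finally show "(P * B * Q) $$ (i, j) = mat n n (\<lambda>(i, j). f (xs ! i) (xs ! j)) $$ (i, j)"
      using ij inx by simp
  qed (auto simp: P_def B_def Q_def)
  have "similar_mat (P * B * Q) B"
  proof (rule similar_matI)
    show "{P * B * Q, B, P, Q} \<subseteq> carrier_mat n n" by (auto simp: P_def Q_def B_def)
  qed (rule PQ QP refl)+
  then show ?thesis
    unfolding PBQ unfolding B_def ny n_def[symmetric] .
qed

lemma graph_matrix_conv:
  assumes "distinct vs"
  shows "graph_matrix vs G X = mat (length vs) (length vs) (\<lambda>(i, j).
    (\<lambda>u v. case X of
       Adjacency \<Rightarrow> (if (u, v) \<in> parcs G then 1 else 0)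
     | Laplacian \<Rightarrow> (if u = v then of_nat (out_degree (with_proj G) u) else 0) - (if (u, v) \<in> parcs G then 1 else 0)
     | Signless_Laplacian \<Rightarrow> (if u = v then of_nat (out_degree (with_proj G) u) else 0) + (if (u, v) \<in> parcs G then 1 else 0))
    (vs ! i) (vs ! j))"
  using assms
  by (cases X; intro eq_matI) (auto simp: adjacency_matrix_def degree_matrix_def nth_eq_iff_index_eq)

lemma graph_spectrum_enum:
  assumes "pair_graph G" "distinct vs" "set vs = pverts G"
  shows "graph_spectrum X G = proots (char_poly (graph_matrix vs G X))"
proof -
  have "set (vertex_enum G) = set vs"
    using vertex_enum(2)[OF assms(1)] assms(3) by simp
  from mat_reindex_similar[OF vertex_enum(1)[OF assms(1)] assms(2) this]
  have "similar_mat (graph_matrix (vertex_enum G) G X) (graph_matrix vs G X)"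
    unfolding graph_matrix_conv[OF assms(2)] graph_matrix_conv[OF vertex_enum(1)[OF assms(1)]] .
  then show ?thesis
    unfolding graph_spectrum_def by (simp add: char_poly_similar)
qed

lemma graph_iso_iff:
  assumes "pair_graph G" "pair_graph H"
  shows "graph_iso G H \<longleftrightarrow> (\<exists>f. bij_betw f (pverts G) (pverts H) \<and>
    (\<forall>u\<in>pverts G. \<forall>v\<in>pverts G. (u, v) \<in> parcs G \<longleftrightarrow> (f u, f v) \<in> parcs H))"
proof
  interpret G: pair_graph G by fact
  assume "graph_iso G H"
  then obtain h where h: "pre_digraph.digraph_isomorphism (with_proj G) h"
      "with_proj H = app_iso h (with_proj G)"
    by (auto simp: graph_iso_def digraph_iso_def)
  have V: "pverts H = iso_verts h ` pverts G" and A: "parcs H = iso_arcs h ` parcs G"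
    and T: "iso_tail h = fst" and D: "iso_head h = snd"
    using arg_cong[OF h(2), of verts] arg_cong[OF h(2), of arcs]
      arg_cong[OF h(2), of tail] arg_cong[OF h(2), of head] by simp_all
  have inj: "inj_on (iso_verts h) (pverts G)"
    and "\<forall>a\<in>parcs G. iso_verts h (fst a) = fst (iso_arcs h a) \<and> iso_verts h (snd a) = snd (iso_arcs h a)"
    using h(1) T D by (auto simp: pre_digraph.digraph_isomorphism_def)
  then have ar: "iso_arcs h (u, v) = (iso_verts h u, iso_verts h v)" if "(u, v) \<in> parcs G" for u v
    using that by (metis fst_conv snd_conv prod.collapse)
  have "(iso_verts h u, iso_verts h v) \<in> parcs H \<longleftrightarrow> (u, v) \<in> parcs G"
    if uv: "u \<in> pverts G" "v \<in> pverts G" for u v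
  proof
    assume "(iso_verts h u, iso_verts h v) \<in> parcs H"
    then obtain a b where ab: "(a, b) \<in> parcs G" "iso_arcs h (a, b) = (iso_verts h u, iso_verts h v)"
      unfolding A by auto
    then have "iso_verts h a = iso_verts h u" "iso_verts h b = iso_verts h v" "a \<in> pverts G" "b \<in> pverts G"
      using ar G.wellformed' by auto
    then show "(u, v) \<in> parcs G" using ab(1) inj uv by (metis inj_onD)
  next
    assume "(u, v) \<in> parcs G"
    then show "(iso_verts h u, iso_verts h v) \<in> parcs H" unfolding A using ar by force
  qed
  then show "\<exists>f. bij_betw f (pverts G) (pverts H) \<and>
    (\<forall>u\<in>pverts G. \<forall>v\<in>pverts G. (u, v) \<in> parcs G \<longleftrightarrow> (f u, f v) \<in> parcs H)"
    using inj V by (intro exI[of _ "iso_verts h"]) (auto simp: bij_betw_def)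
next
  interpret G: pair_graph G by fact
  interpret H: pair_graph H by fact
  assume "\<exists>f. bij_betw f (pverts G) (pverts H) \<and>
    (\<forall>u\<in>pverts G. \<forall>v\<in>pverts G. (u, v) \<in> parcs G \<longleftrightarrow> (f u, f v) \<in> parcs H)"
  then obtain f where f: "inj_on f (pverts G)" "f ` pverts G = pverts H"
    "\<And>u v. u \<in> pverts G \<Longrightarrow> v \<in> pverts G \<Longrightarrow> (u, v) \<in> parcs G \<longleftrightarrow> (f u, f v) \<in> parcs H"
    by (auto simp: bij_betw_def)
  define h where "h = \<lparr> iso_verts = f, iso_arcs = map_prod f f, iso_head = snd, iso_tail = fst \<rparr>"
  have "inj_on (map_prod f f) (parcs G)"
    by (rule inj_on_subset[OF map_prod_inj_on[OF f(1) f(1)]]) (auto dest: G.wellformed')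
  then have "pre_digraph.digraph_isomorphism (with_proj G) h"
    using f(1) G.wf_digraph unfolding pre_digraph.digraph_isomorphism_def h_def by simp
  moreover have "map_prod f f ` parcs G = parcs H"
  proof (intro equalityI subrelI)
    fix x y assume xy: "(x, y) \<in> parcs H"
    then have "x \<in> f ` pverts G" "y \<in> f ` pverts G" using f(2) H.wellformed' by auto
    then obtain u v where "u \<in> pverts G" "v \<in> pverts G" "x = f u" "y = f v" by auto
    moreover from this have "(u, v) \<in> parcs G" using xy f(3) by simp
    ultimately show "(x, y) \<in> map_prod f f ` parcs G" by force
  next
    fix x y assume "(x, y) \<in> map_prod f f ` parcs G"
    then obtain u v where "(u, v) \<in> parcs G" "x = f u" "y = f v" by auto
    then show "(x, y) \<in> parcs H" using f(3)[OF G.in_arcsD1 G.in_arcsD2] by blast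
  qed
  then have "with_proj H = app_iso h (with_proj G)"
    using f(2) by (simp add: with_proj_def app_iso_def h_def)
  ultimately show "graph_iso G H" by (auto simp: graph_iso_def digraph_iso_def)
qed

lemma pair_graph_iff:
  "pair_graph G \<longleftrightarrow> finite (pverts G) \<and> parcs G \<subseteq> pverts G \<times> pverts G \<and> sym (parcs G) \<and> irrefl (parcs G)"
proof
  assume "pair_graph G"
  then interpret pair_graph G .
  show "finite (pverts G) \<and> parcs G \<subseteq> pverts G \<times> pverts G \<and> sym (parcs G) \<and> irrefl (parcs G)"
  proof (intro conjI)
    show "finite (pverts G)" by (rule pair_finite_verts)
    show "parcs G \<subseteq> pverts G \<times> pverts G" using wellformed' by auto
    show "sym (parcs G)" using arcs_symmetric by (rule symI)
    show "irrefl (parcs G)" using no_loops' by (metis irreflI)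
  qed
next
  assume *: "finite (pverts G) \<and> parcs G \<subseteq> pverts G \<times> pverts G \<and> sym (parcs G) \<and> irrefl (parcs G)"
  then have "finite (parcs G)" by (meson finite_SigmaI finite_subset)
  with * show "pair_graph G"
    by unfold_locales (auto simp: symmetric_def irrefl_def)
qed

lemma pair_graph_splitting_join:
  assumes "pair_graph G1" "pair_graph G2" "R \<subseteq> pverts G1 \<times> pverts G1"
  shows "pair_graph (splitting_join R G1 G2)"
proof -
  have 1: "finite (pverts G1)" "parcs G1 \<subseteq> pverts G1 \<times> pverts G1" "sym (parcs G1)" "irrefl (parcs G1)"
    and 2: "finite (pverts G2)" "parcs G2 \<subseteq> pverts G2 \<times> pverts G2" "sym (parcs G2)" "irrefl (parcs G2)"
    using assms by (auto simp: pair_graph_iff)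
  have s: "sym (map_prod f f ` S)" if "sym S" for f :: "'c \<Rightarrow> 'd" and S
    using that by (force simp: sym_def)
  have i: "irrefl (map_prod f f ` S)" if "irrefl S" "inj f" for f :: "'c \<Rightarrow> 'd" and S
    using that by (auto simp: irrefl_def inj_def)
  have sy: "sym (parcs (splitting_join R G1 G2))"
    using s[OF 1(3), of Fst] s[OF 2(3), of Snd]
    unfolding splitting_join_def join_def sym_def by simp blast
  have ir: "irrefl (parcs (splitting_join R G1 G2))"
    using i[OF 1(4), of Fst] i[OF 2(4), of Snd]
    unfolding splitting_join_def join_def irrefl_def inj_def by auto
  have "finite (pverts (splitting_join R G1 G2))"
    using 1(1) 2(1) by (simp add: splitting_join_def join_def)
  moreover have "parcs (splitting_join R G1 G2)
      \<subseteq> pverts (splitting_join R G1 G2) \<times> pverts (splitting_join R G1 G2)"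
    using 1(2) 2(2) assms(3) unfolding splitting_join_def join_def by fastforce
  ultimately show ?thesis
    using sy ir by (simp add: pair_graph_iff)
qed

lemma pair_graph_NS_join:
  "pair_graph G1 \<Longrightarrow> pair_graph G2 \<Longrightarrow> pair_graph (NS_join G1 G2)"
  unfolding NS_join_def by (rule pair_graph_splitting_join) (auto simp: pair_graph_iff)

lemma pair_graph_NNS_join:
  "pair_graph G1 \<Longrightarrow> pair_graph G2 \<Longrightarrow> pair_graph (NNS_join G1 G2)"
  unfolding NNS_join_def by (rule pair_graph_splitting_join) auto

end

theory Submission
  imports Defs "HOL-Computational_Algebra.Fundamental_Theorem_Algebra"
begin

text \<open>
  Both joins are splitting joins for an irreflexive relation on the vertices of \<open>G\<close>.

  The vertices of \<open>F\<close> have degree \<open>r + n\<close> in the join, where \<open>n\<close> is the order of \<open>G\<close>, and the new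
  vertices have degree less than \<open>n\<close>. Hence the vertices of degree \<open>r + n\<close> induce the join of \<open>F\<close>
  with an induced subgraph of \<open>G\<close> that depends only on the order of \<open>F\<close>. Joins become disjoint unions
  under complementation, so this common part can be cancelled, and \<open>F\<close> is determined by the join.

  In the matrices of the join, the block of \<open>F\<close> has constant column sums and meets the other blocks
  in constant rows. Eliminating these, the characteristic polynomial depends on \<open>F\<close> only through its
  order, \<open>r\<close>, and the characteristic polynomial of \<open>F\<close>, first outside one exceptional value of the
  variable and then everywhere.
\<close>

section \<open>Cancelling a common part\<close>

text \<open>The trajectory of \<open>x\<close>: a value \<open>Inl w\<close> lies in the common part
  and is fed back into \<open>\<phi>\<close>, while a value \<open>Inr b\<close> ends the
  trajectory. This is the usual device for subtracting a common summand from a bijection.\<close>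

inductive reach :: "('w + 'a \<Rightarrow> 'w + 'b) \<Rightarrow> 'a \<Rightarrow> 'w + 'b \<Rightarrow> bool" for \<phi> x where
  start: "reach \<phi> x (\<phi> (Inr x))"
| step: "reach \<phi> x (Inl w) \<Longrightarrow> reach \<phi> x (\<phi> (Inl w))"

lemma reach_in:
  assumes "reach \<phi> x v" "x \<in> A" "\<phi> ` (W <+> A) \<subseteq> W <+> B"
  shows "v \<in> W <+> B"
  using assms(1) by induction (use assms(2,3) in blast)+

text \<open>The two trajectories are traced back together: \<open>\<phi>\<close> pulls
  \<open>Q\<close> back to \<open>P\<close>, which on \<open>W\<close> is \<open>Q\<close> again. As
  \<open>P\<close> relates no vertex of \<open>W\<close> to one of \<open>A\<close>, both arrive at
  their starts simultaneously.\<close>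

lemma reach_backward:
  assumes "reach \<phi> x v" "reach \<phi> y v'" "Q v v'" "x \<in> A" "y \<in> A"
    and \<phi>: "\<phi> ` (W <+> A) \<subseteq> W <+> B"
    and PQ: "\<And>u v. u \<in> W <+> A \<Longrightarrow> v \<in> W <+> A \<Longrightarrow> P u v \<longleftrightarrow> Q (\<phi> u) (\<phi> v)"
    and P: "\<And>w a. w \<in> W \<Longrightarrow> a \<in> A \<Longrightarrow> \<not> P (Inl w) (Inr a) \<and> \<not> P (Inr a) (Inl w)"
    and W: "\<And>w w'. w \<in> W \<Longrightarrow> w' \<in> W \<Longrightarrow> P (Inl w) (Inl w') \<longleftrightarrow> Q (Inl w) (Inl w')"
  shows "P (Inr x) (Inr y)"
  using assms(1-3)
proof (induction arbitrary: v')
  case start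
  from start(1) show ?case
  proof cases
    case start
    then show ?thesis
      using PQ[of "Inr x" "Inr y"] \<open>Q _ v'\<close> \<open>x \<in> A\<close> \<open>y \<in> A\<close> by auto
  next
    case (step w)
    then have "w \<in> W" using reach_in[OF step(2) \<open>y \<in> A\<close> \<phi>] by auto
    then show ?thesis
      using step(1) PQ[of "Inr x" "Inl w"] P[of w x] \<open>Q _ v'\<close> \<open>x \<in> A\<close> by auto
  qed
next
  case (step w)
  have w: "w \<in> W" using reach_in[OF step(1) \<open>x \<in> A\<close> \<phi>] by auto
  note IH = step(2) and Q = step(4)
  from step(3) show ?case
  proof cases
    case start
    then show ?thesis
      using w PQ[of "Inl w" "Inr y"] P[of w y] Q \<open>y \<in> A\<close> by auto
  next
    case (step w')
    then have w': "w' \<in> W" using reach_in[OF step(2) \<open>y \<in> A\<close> \<phi>] by auto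
    then have "Q (Inl w) (Inl w')"
      using step(1) w PQ[of "Inl w" "Inl w'"] W[of w w'] Q by auto
    with step(2) show ?thesis by (rule IH)
  qed
qed

text \<open>While the trajectory of \<open>x\<close> is in \<open>W\<close>, so is the companion
  point on that of \<open>y\<close>, since \<open>Q\<close> relates no vertex of \<open>W\<close> to
  one of \<open>B\<close>; hence both can advance.\<close>

lemma reach_forward:
  assumes "reach \<phi> x v" "P (Inr x) (Inr y)" "x \<in> A" "y \<in> A"
    and \<phi>: "\<phi> ` (W <+> A) \<subseteq> W <+> B"
    and PQ: "\<And>u v. u \<in> W <+> A \<Longrightarrow> v \<in> W <+> A \<Longrightarrow> P u v \<longleftrightarrow> Q (\<phi> u) (\<phi> v)"
    and Q: "\<And>w b. w \<in> W \<Longrightarrow> b \<in> B \<Longrightarrow> \<not> Q (Inl w) (Inr b)"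
    and W: "\<And>w w'. w \<in> W \<Longrightarrow> w' \<in> W \<Longrightarrow> P (Inl w) (Inl w') \<longleftrightarrow> Q (Inl w) (Inl w')"
  shows "\<exists>v'. reach \<phi> y v' \<and> Q v v'"
  using assms(1)
proof induction
  case start
  have "Q (\<phi> (Inr x)) (\<phi> (Inr y))"
    using PQ[of "Inr x" "Inr y"] assms(2-4) by auto
  then show ?case using reach.start[of \<phi> y] by blast
next
  case (step w)
  then obtain v' where v': "reach \<phi> y v'" "Q (Inl w) v'" by blast
  have w: "w \<in> W" using reach_in[OF step(1) \<open>x \<in> A\<close> \<phi>] by auto
  have "v' \<in> W <+> B" by (rule reach_in[OF v'(1) \<open>y \<in> A\<close> \<phi>])
  with v'(2) Q[OF w] obtain w' where w': "v' = Inl w'" "w' \<in> W" by (auto elim!: PlusE)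
  then have "Q (\<phi> (Inl w)) (\<phi> (Inl w'))"
    using v' w PQ[of "Inl w" "Inl w'"] W[of w w'] by auto
  then show ?case using v'(1) w'(1) reach.step[of \<phi> y w'] by blast
qed

text \<open>If the trajectory never left \<open>W\<close>, then \<open>\<phi>\<close> would map the
  finite set \<open>T\<close> of its points together with the extra point \<open>Inr x\<close>
  injectively into \<open>T\<close>, against the pigeonhole principle.\<close>

lemma reach_Inr:
  assumes "finite W" "x \<in> A" and \<phi>: "\<phi> ` (W <+> A) \<subseteq> W <+> B" "inj_on \<phi> (W <+> A)"
  shows "\<exists>b\<in>B. reach \<phi> x (Inr b)"
proof (rule ccontr)
  assume none: "\<not> ?thesis"
  define T where "T = {w. reach \<phi> x (Inl w)}"
  have T: "T \<subseteq> W"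
    using reach_in[OF _ \<open>x \<in> A\<close> \<phi>(1)] unfolding T_def by blast
  have "v \<in> Inl ` T" if "reach \<phi> x v" for v
    using that none reach_in[OF that \<open>x \<in> A\<close> \<phi>(1)] unfolding T_def by auto
  then have "\<phi> ` insert (Inr x) (Inl ` T) \<subseteq> Inl ` T"
    using reach.intros[of \<phi> x] unfolding T_def by auto
  moreover have "inj_on \<phi> (insert (Inr x) (Inl ` T))"
    by (rule inj_on_subset[OF \<phi>(2)]) (use T \<open>x \<in> A\<close> in auto)
  moreover have "finite T" using T \<open>finite W\<close> by (rule finite_subset)
  ultimately have "card (insert (Inr x :: 'a + 'b) (Inl ` T)) \<le> card (Inl ` T :: ('a + 'c) set)"
    by (intro card_inj_on_le) auto
  then show False
    using \<open>finite T\<close> by (subst (asm) card_insert_disjoint) (auto simp: card_image)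
qed

text \<open>
  An edge-preserving bijection maps no connected component into both summands, so following \<open>\<phi>\<close>
  from a vertex of \<open>A\<close> until it leaves \<open>W\<close> treats whole components of \<open>A\<close> alike.
\<close>

lemma disjoint_union_cancel:
  assumes fin: "finite W" "finite A"
    and \<phi>: "bij_betw \<phi> (W <+> A) (W <+> B)"
    and PQ: "\<And>u v. u \<in> W <+> A \<Longrightarrow> v \<in> W <+> A \<Longrightarrow> P u v \<longleftrightarrow> Q (\<phi> u) (\<phi> v)"
    and P: "\<And>w a. w \<in> W \<Longrightarrow> a \<in> A \<Longrightarrow> \<not> P (Inl w) (Inr a) \<and> \<not> P (Inr a) (Inl w)"
    and Q: "\<And>w b. w \<in> W \<Longrightarrow> b \<in> B \<Longrightarrow> \<not> Q (Inl w) (Inr b) \<and> \<not> Q (Inr b) (Inl w)"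
    and W: "\<And>w w'. w \<in> W \<Longrightarrow> w' \<in> W \<Longrightarrow> P (Inl w) (Inl w') \<longleftrightarrow> Q (Inl w) (Inl w')"
  shows "\<exists>\<psi>. bij_betw \<psi> A B \<and>
    (\<forall>x\<in>A. \<forall>y\<in>A. P (Inr x) (Inr y) \<longleftrightarrow> Q (Inr (\<psi> x)) (Inr (\<psi> y)))"
proof -
  have inj: "inj_on \<phi> (W <+> A)" and im: "\<phi> ` (W <+> A) \<subseteq> W <+> B"
    using \<phi> by (auto simp: bij_betw_def)
  have "finite (W <+> B)" using bij_betw_finite[OF \<phi>] fin by auto
  then have finB: "finite B" by (auto simp: finite_Plus_iff)
  have "card (W <+> A) = card (W <+> B)" by (rule bij_betw_same_card[OF \<phi>])
  then have card: "card A = card B" using fin finB by (simp add: card_Plus)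
  obtain \<psi> where \<psi>: "\<psi> x \<in> B" "reach \<phi> x (Inr (\<psi> x))" if "x \<in> A" for x
    using bchoice[of A "\<lambda>x b. b \<in> B \<and> reach \<phi> x (Inr b)"] reach_Inr[OF fin(1) _ im inj] by blast
  \<comment> \<open>With equality as both relations, tracing back says that trajectories with a
    common point have the same start.\<close>
  have eq: "x = y" if "reach \<phi> x v" "reach \<phi> y v" "x \<in> A" "y \<in> A" for x y v
    using reach_backward[where P = "(=)" and Q = "(=)", OF that(1,2) refl that(3,4) im] inj
    by (auto simp: inj_on_eq_iff)
  have injpsi: "inj_on \<psi> A"
  proof (rule inj_onI)
    fix x y assume "x \<in> A" "y \<in> A" "\<psi> x = \<psi> y"
    then show "x = y" using eq[of x "Inr (\<psi> x)" y] \<psi>(2)[of x] \<psi>(2)[of y] by simp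
  qed
  then have "\<psi> ` A = B"
    using \<psi>(1) card finB by (intro card_subset_eq) (auto simp: card_image)
  with injpsi have bij: "bij_betw \<psi> A B" by (simp add: bij_betw_def)
  have "P (Inr x) (Inr y) \<longleftrightarrow> Q (Inr (\<psi> x)) (Inr (\<psi> y))" if xy: "x \<in> A" "y \<in> A" for x y
  proof
    assume "Q (Inr (\<psi> x)) (Inr (\<psi> y))"
    from reach_backward[of \<phi> x _ y _ Q, OF \<psi>(2) \<psi>(2) this xy im PQ P W] xy
    show "P (Inr x) (Inr y)" by blast
  next
    assume "P (Inr x) (Inr y)"
    from reach_forward[of \<phi> x _ P, OF \<psi>(2) this xy im PQ _ W] Q xy
    obtain v where v: "reach \<phi> y v" "Q (Inr (\<psi> x)) v" by blast
    then obtain b where b: "v = Inr b" "b \<in> B"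
      using Q \<psi>(1) xy reach_in[OF v(1) \<open>y \<in> A\<close> im] by auto
    \<comment> \<open>By surjectivity \<open>b\<close> ends the trajectory of some \<open>z\<close>;
      it also lies on that of \<open>y\<close>, so \<open>z = y\<close>.\<close>
    then obtain z where "z \<in> A" "b = \<psi> z" using \<open>\<psi> ` A = B\<close> by blast
    with eq[of z v y] b v(1) \<psi>(2)[of z] xy(2) have "b = \<psi> y" by simp
    with v b show "Q (Inr (\<psi> x)) (Inr (\<psi> y))" by simp
  qed
  with bij show ?thesis by blast
qed


section \<open>Degrees in splitting joins\<close>

lemma out_degree_card: "out_degree (with_proj G) v = card (parcs G `` {v})"
proof -
  have "out_arcs (with_proj G) v = Pair v ` (parcs G `` {v})"
    by (auto simp: out_arcs_def)
  then show ?thesis by (simp add: out_degree_def card_image inj_on_def)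
qed

lemma pverts_splitting_join [simp]:
  "pverts (splitting_join R G F) = Fst ` pverts G \<union> Snd ` pverts F \<union> Copy ` pverts G"
  by (simp add: splitting_join_def join_def)

lemma parcs_splitting_join [simp]:
  "(Fst u, Fst v) \<in> parcs (splitting_join R G F) \<longleftrightarrow> (u, v) \<in> parcs G"
  "(Snd x, Snd y) \<in> parcs (splitting_join R G F) \<longleftrightarrow> (x, y) \<in> parcs F"
  "(Fst u, Snd x) \<in> parcs (splitting_join R G F) \<longleftrightarrow> u \<in> pverts G \<and> x \<in> pverts F"
  "(Snd x, Fst u) \<in> parcs (splitting_join R G F) \<longleftrightarrow> u \<in> pverts G \<and> x \<in> pverts F"
  "(Copy u, Fst v) \<in> parcs (splitting_join R G F) \<longleftrightarrow> (u, v) \<in> R"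
  "(Fst v, Copy u) \<in> parcs (splitting_join R G F) \<longleftrightarrow> (u, v) \<in> R"
  "(Copy u, Snd x) \<notin> parcs (splitting_join R G F)"
  "(Snd x, Copy u) \<notin> parcs (splitting_join R G F)"
  "(Copy u, Copy v) \<notin> parcs (splitting_join R G F)"
  by (force simp: splitting_join_def join_def)+

lemma nbrs_splitting_join:
  "u \<in> pverts G \<Longrightarrow> parcs (splitting_join R G F) `` {Fst u} =
    Fst ` (parcs G `` {u}) \<union> Snd ` pverts F \<union> Copy ` (R\<inverse> `` {u})"
  "x \<in> pverts F \<Longrightarrow> parcs (splitting_join R G F) `` {Snd x} =
    Snd ` (parcs F `` {x}) \<union> Fst ` pverts G"
  "parcs (splitting_join R G F) `` {Copy u} = Fst ` (R `` {u})"
proof -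
  show "parcs (splitting_join R G F) `` {Fst u} =
      Fst ` (parcs G `` {u}) \<union> Snd ` pverts F \<union> Copy ` (R\<inverse> `` {u})" if "u \<in> pverts G"
    apply (intro Set.set_eqI)
    subgoal for v using that by (cases v) auto
    done
  show "parcs (splitting_join R G F) `` {Snd x} = Snd ` (parcs F `` {x}) \<union> Fst ` pverts G"
    if "x \<in> pverts F"
    apply (intro Set.set_eqI)
    subgoal for v using that by (cases v) auto
    done
  show "parcs (splitting_join R G F) `` {Copy u} = Fst ` (R `` {u})"
    apply (intro Set.set_eqI)
    subgoal for v by (cases v) auto
    done
qed

lemma degree_splitting_join:
  assumes "pair_graph G" "pair_graph F" and R: "R \<subseteq> pverts G \<times> pverts G"
  shows "u \<in> pverts G \<Longrightarrow> out_degree (with_proj (splitting_join R G F)) (Fst u) =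
      card (parcs G `` {u}) + card (pverts F) + card (R\<inverse> `` {u})"
    and "x \<in> pverts F \<Longrightarrow> out_degree (with_proj (splitting_join R G F)) (Snd x) =
      out_degree (with_proj F) x + card (pverts G)"
    and "out_degree (with_proj (splitting_join R G F)) (Copy u) = card (R `` {u})"
proof -
  have G: "finite (pverts G)" "parcs G \<subseteq> pverts G \<times> pverts G"
    and F: "finite (pverts F)" "parcs F \<subseteq> pverts F \<times> pverts F"
    using assms(1,2) by (auto simp: pair_graph_iff)
  have fin: "finite (parcs G `` {u})" "finite (R\<inverse> `` {u})" for u
    by (rule finite_subset[OF _ G(1)], use G(2) R in blast)+
  have fin': "finite (parcs F `` {x})" for x
    by (rule finite_subset[OF _ F(1)]) (use F(2) in blast)
  show "out_degree (with_proj (splitting_join R G F)) (Fst u) =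
      card (parcs G `` {u}) + card (pverts F) + card (R\<inverse> `` {u})" if "u \<in> pverts G"
    unfolding out_degree_card nbrs_splitting_join(1)[OF that] using fin F(1)
    by (subst card_Un_disjoint; auto simp: card_image inj_on_def)+
  show "out_degree (with_proj (splitting_join R G F)) (Snd x) =
      out_degree (with_proj F) x + card (pverts G)" if "x \<in> pverts F"
    unfolding out_degree_card nbrs_splitting_join(2)[OF that] using fin' G(1)
    by (subst card_Un_disjoint) (auto simp: card_image inj_on_def)
  show "out_degree (with_proj (splitting_join R G F)) (Copy u) = card (R `` {u})"
    unfolding out_degree_card nbrs_splitting_join(3) by (simp add: card_image inj_on_def)
qed

lemma card_pverts_splitting_join:
  assumes "pair_graph G" "pair_graph F"
  shows "card (pverts (splitting_join R G F)) = 2 * card (pverts G) + card (pverts F)"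
proof -
  have "finite (pverts G)" "finite (pverts F)" using assms by (auto simp: pair_graph_iff)
  then have "card (Fst ` pverts G \<union> Snd ` pverts F \<union> Copy ` pverts G) =
      card (pverts G) + card (pverts F) + card (pverts G)"
    by (subst card_Un_disjoint; auto simp: card_image inj_on_def)+
  then show ?thesis by simp
qed

section \<open>Recovering the second graph\<close>

text \<open>The image under \<open>case_sum Fst Snd\<close> presents the class as a disjoint sum,
  the form in which the part from \<open>G\<close> can be cancelled.\<close>

lemma degree_class_splitting_join:
  assumes "pair_graph G" "pair_graph F" "regular r F"
    and R: "R \<subseteq> pverts G \<times> pverts G" "irrefl R"
  shows "{v \<in> pverts (splitting_join R G F).
      out_degree (with_proj (splitting_join R G F)) v = r + card (pverts G)} =
    case_sum Fst Snd ` ({u \<in> pverts G. card (parcs G `` {u}) + card (pverts F) + card (R\<inverse> `` {u})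
      = r + card (pverts G)} <+> pverts F)"
proof -
  note deg = degree_splitting_join[OF assms(1,2) R(1)]
  have "finite (pverts G)" using assms(1) by (simp add: pair_graph_iff)
  \<comment> \<open>By irreflexivity \<open>u\<close> is not among its own
    \<open>R\<close>-successors, which therefore form a proper subset of the vertices of
    \<open>G\<close>.\<close>
  have "card (R `` {u}) < card (pverts G)" if "u \<in> pverts G" for u
    by (rule psubset_card_mono[OF \<open>finite (pverts G)\<close>]) (use that R in \<open>auto simp: irrefl_def\<close>)
  then have copy: "card (R `` {u}) \<noteq> r + card (pverts G)" if "u \<in> pverts G" for u
    using that by fastforce
  have "out_degree (with_proj F) x = r" if "x \<in> pverts F" for x
    using that assms(3) by (simp add: regular_def)
  then show ?thesis
    using copy deg by (auto simp: Plus_def image_Un image_image)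
qed

text \<open>Isomorphisms carry neighbourhoods onto neighbourhoods and so preserve degrees.\<close>

lemma bij_betw_degree_class:
  assumes "pair_graph G" "pair_graph H" and f: "bij_betw f (pverts G) (pverts H)"
    and arc: "\<And>u v. u \<in> pverts G \<Longrightarrow> v \<in> pverts G \<Longrightarrow> (u, v) \<in> parcs G \<longleftrightarrow> (f u, f v) \<in> parcs H"
  shows "bij_betw f {v \<in> pverts G. out_degree (with_proj G) v = d}
    {v \<in> pverts H. out_degree (with_proj H) v = d}"
proof -
  have GH: "parcs G \<subseteq> pverts G \<times> pverts G" "parcs H \<subseteq> pverts H \<times> pverts H"
    using assms by (auto simp: pair_graph_iff)
  have inj: "inj_on f (pverts G)" and im: "f ` pverts G = pverts H"
    using f by (auto simp: bij_betw_def)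
  have "out_degree (with_proj H) (f v) = out_degree (with_proj G) v" if v: "v \<in> pverts G" for v
  proof -
    have "parcs H `` {f v} = f ` (parcs G `` {v})"
    proof (intro equalityI subsetI)
      fix y assume y: "y \<in> parcs H `` {f v}"
      then obtain w where "w \<in> pverts G" "y = f w" using GH im by blast
      with y arc[OF v this(1)] show "y \<in> f ` (parcs G `` {v})" by auto
    next
      fix y assume "y \<in> f ` (parcs G `` {v})"
      then obtain w where w: "(v, w) \<in> parcs G" "y = f w" by auto
      with GH have "w \<in> pverts G" by auto
      with w arc[OF v this] show "y \<in> parcs H `` {f v}" by auto
    qed
    moreover have "inj_on f (parcs G `` {v})"
      by (rule inj_on_subset[OF inj]) (use GH in blast)
    ultimately show ?thesis by (simp add: out_degree_card card_image)
  qed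
  then have "f ` {v \<in> pverts G. out_degree (with_proj G) v = d} =
      {v \<in> pverts H. out_degree (with_proj H) v = d}"
    unfolding im[symmetric] by auto
  then show ?thesis
    using inj by (auto simp: bij_betw_def inj_on_def)
qed

lemma splitting_join_iso_cancel:
  assumes G: "pair_graph G" and F: "pair_graph F" and H: "pair_graph H"
    and reg: "regular r F" "regular r H"
    and R: "R \<subseteq> pverts G \<times> pverts G" "irrefl R"
    and iso: "graph_iso (splitting_join R G F) (splitting_join R G H)"
  shows "graph_iso F H"
proof -
  let ?F = "splitting_join R G F" and ?H = "splitting_join R G H"
  let ?s = "case_sum Fst Snd"
  have JF: "pair_graph ?F" and JH: "pair_graph ?H"
    using pair_graph_splitting_join G F H R(1) by blast+
  obtain f where f: "bij_betw f (pverts ?F) (pverts ?H)"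
    and arc: "\<And>u v. u \<in> pverts ?F \<Longrightarrow> v \<in> pverts ?F \<Longrightarrow> (u, v) \<in> parcs ?F \<longleftrightarrow> (f u, f v) \<in> parcs ?H"
    using iso unfolding graph_iso_iff[OF JF JH] by blast
  have m: "card (pverts F) = card (pverts H)"
    using bij_betw_same_card[OF f]
    unfolding card_pverts_splitting_join[OF G F] card_pverts_splitting_join[OF G H] by simp
  \<comment> \<open>\<open>W\<close> depends on the second graph only through its order, so by
    \<open>m\<close> it is the same set for \<open>F\<close> and \<open>H\<close>.\<close>
  define W where "W = {u \<in> pverts G. card (parcs G `` {u}) + card (pverts F) + card (R\<inverse> `` {u})
    = r + card (pverts G)}"
  have fin: "finite W" "finite (pverts F)"
    using G F by (auto simp: W_def pair_graph_iff)
  have cF: "{v \<in> pverts ?F. out_degree (with_proj ?F) v = r + card (pverts G)} = ?s ` (W <+> pverts F)"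
    unfolding W_def by (rule degree_class_splitting_join[OF G F reg(1) R])
  have cH: "{v \<in> pverts ?H. out_degree (with_proj ?H) v = r + card (pverts G)} = ?s ` (W <+> pverts H)"
    unfolding W_def m by (rule degree_class_splitting_join[OF G H reg(2) R])
  have fc: "bij_betw f (?s ` (W <+> pverts F)) (?s ` (W <+> pverts H))"
    using bij_betw_degree_class[OF JF JH f arc, of "r + card (pverts G)"] unfolding cF cH .
  have sF: "bij_betw ?s (W <+> pverts F) (?s ` (W <+> pverts F))"
    and sH: "bij_betw ?s (W <+> pverts H) (?s ` (W <+> pverts H))"
    by (auto simp: bij_betw_def inj_on_def)
  \<comment> \<open>The isomorphism, read through the encodings of the two degree classes as
    sums.\<close>
  define \<phi> where "\<phi> = inv_into (W <+> pverts H) ?s \<circ> (f \<circ> ?s)"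
  have \<phi>: "bij_betw \<phi> (W <+> pverts F) (W <+> pverts H)"
    unfolding \<phi>_def by (rule bij_betw_trans[OF bij_betw_trans[OF sF fc] bij_betw_inv_into[OF sH]])
  have s\<phi>: "?s (\<phi> u) = f (?s u)" if "u \<in> W <+> pverts F" for u
    using bij_betw_apply[OF fc imageI[OF that, of ?s]] by (auto simp: \<phi>_def intro!: f_inv_into_f)
  have sub: "?s u \<in> pverts ?F" if "u \<in> W <+> pverts F" for u
    using that by (auto simp: W_def)
  \<comment> \<open>Cancellation is applied to non-adjacency: the join has all edges between
    \<open>W\<close> and the second graph, so the complement has none.\<close>
  have "\<exists>\<psi>. bij_betw \<psi> (pverts F) (pverts H) \<and> (\<forall>x\<in>pverts F. \<forall>y\<in>pverts F.
      (?s (Inr x), ?s (Inr y)) \<notin> parcs ?F \<longleftrightarrow> (?s (Inr (\<psi> x)), ?s (Inr (\<psi> y))) \<notin> parcs ?H)"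
  proof (rule disjoint_union_cancel[OF fin \<phi>])
    fix u v assume uv: "u \<in> W <+> pverts F" "v \<in> W <+> pverts F"
    show "(?s u, ?s v) \<notin> parcs ?F \<longleftrightarrow> (?s (\<phi> u), ?s (\<phi> v)) \<notin> parcs ?H"
      unfolding s\<phi>[OF uv(1)] s\<phi>[OF uv(2)] using arc[OF sub[OF uv(1)] sub[OF uv(2)]] by simp
  qed (simp_all add: W_def)
  then show ?thesis
    unfolding graph_iso_iff[OF F H] by simp
qed


section \<open>The spectrum of a splitting join\<close>

text \<open>Entries are given by labels instead of positions, so that appending lists yields block
  matrices and mapping over a list relabels.\<close>

definition fmat :: "'a list \<Rightarrow> 'b list \<Rightarrow> ('a \<Rightarrow> 'b \<Rightarrow> 'c) \<Rightarrow> 'c mat" where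
  "fmat xs ys f = mat (length xs) (length ys) (\<lambda>(i, j). f (xs ! i) (ys ! j))"

lemma fmat_carrier [simp]: "fmat xs ys f \<in> carrier_mat (length xs) (length ys)"
  by (simp add: fmat_def)

lemma fmat_index [simp]:
  "i < length xs \<Longrightarrow> j < length ys \<Longrightarrow> fmat xs ys f $$ (i, j) = f (xs ! i) (ys ! j)"
  by (simp add: fmat_def)

lemma fmat_dim [simp]: "dim_row (fmat xs ys f) = length xs" "dim_col (fmat xs ys f) = length ys"
  by (simp_all add: fmat_def)

lemma fmat_append: "fmat (xs @ ys) (xs @ ys) f =
    four_block_mat (fmat xs xs f) (fmat xs ys f) (fmat ys xs f) (fmat ys ys f)"
  by (rule eq_matI) (auto simp: nth_append)

lemma fmat_map: "fmat (map g xs) (map h ys) f = fmat xs ys (\<lambda>a b. f (g a) (h b))"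
  by (rule eq_matI) auto

lemma fmat_cong:
  "(\<And>a b. a \<in> set xs \<Longrightarrow> b \<in> set ys \<Longrightarrow> f a b = g a b) \<Longrightarrow> fmat xs ys f = fmat xs ys g"
  by (rule eq_matI) auto

text \<open>
  The row operation subtracts multiples of the sum of the rows of \<open>N\<close>, which is \<open>s\<close> times the
  all-one vector; so \<open>N\<close> enters the Schur complement only through \<open>s\<close>.
\<close>

lemma det_four_block_constant_col_sums:
  fixes N :: "'a :: field mat"
  assumes K: "K \<in> carrier_mat k k" and N: "N \<in> carrier_mat m m"
    and s: "\<And>j. j < m \<Longrightarrow> (\<Sum>i = 0..<m. N $$ (i, j)) = s" "s \<noteq> 0"
  shows "det (four_block_mat K (mat k m (\<lambda>(i, j). e i)) (mat m k (\<lambda>(i, j). e j)) N)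
    = det (mat k k (\<lambda>(i, j). K $$ (i, j) - of_nat m / s * e i * e j)) * det N"
proof -
  define B where "B = mat k m (\<lambda>(i, j). e i)"
  define D where "D = mat m k (\<lambda>(i, j). e j)"
  \<comment> \<open>Each row of \<open>C\<close> is a multiple of the all-one row, chosen so that
    \<open>C * N\<close> is \<open>- B\<close>.\<close>
  define C where "C = mat k m (\<lambda>(i, j). - (e i / s))"
  define S where "S = mat k k (\<lambda>(i, j). K $$ (i, j) - of_nat m / s * e i * e j)"
  have car: "B \<in> carrier_mat k m" "D \<in> carrier_mat m k" "C \<in> carrier_mat k m" "S \<in> carrier_mat k k"
    by (auto simp: B_def C_def D_def S_def)
  have KS: "1\<^sub>m k * K + C * D = S"
    by (rule eq_matI) (use K in \<open>auto simp: C_def D_def S_def scalar_prod_def\<close>)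
  have "(C * N) $$ (i, j) = - e i" if "i < k" "j < m" for i j
  proof -
    have "(C * N) $$ (i, j) = (\<Sum>l = 0..<m. - (e i / s) * N $$ (l, j))"
      using that N by (auto simp: C_def scalar_prod_def)
    also have "\<dots> = - (e i / s) * s"
      unfolding sum_distrib_left[symmetric] s(1)[OF that(2)] ..
    finally show ?thesis using s(2) by simp
  qed
  then have BN: "1\<^sub>m k * B + C * N = 0\<^sub>m k m"
    by (intro eq_matI) (use N in \<open>auto simp: B_def C_def\<close>)
  have "four_block_mat (1\<^sub>m k) C (0\<^sub>m m k) (1\<^sub>m m) * four_block_mat K B D N
      = four_block_mat S (0\<^sub>m k m) D N"
    using mult_four_block_mat[OF one_carrier_mat car(3) zero_carrier_mat one_carrier_mat K car(1,2) N]
      KS BN K N car by simp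
  moreover have "det (four_block_mat (1\<^sub>m k) C (0\<^sub>m m k) (1\<^sub>m m)) = 1"
    by (subst det_four_block_mat_lower_left_zero[of _ k _ m]) (use car in auto)
  moreover have "det (four_block_mat S (0\<^sub>m k m) D N) = det S * det N"
    by (rule det_four_block_mat_upper_right_zero) (use car N in auto)
  ultimately have "det (four_block_mat K B D N) = det S * det N"
    using det_mult[of "four_block_mat (1\<^sub>m k) C (0\<^sub>m m k) (1\<^sub>m m)" "k + m" "four_block_mat K B D N"]
      K N car by (simp add: four_block_carrier_mat)
  then show ?thesis unfolding B_def D_def S_def .
qed

section \<open>Characteristic matrices of graphs\<close>

text \<open>Together with \<open>arc_coeff\<close> this writes every \<open>graph_matrix\<close> as
  a combination of the degree and adjacency matrices, so that one computation serves all three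
  types.\<close>

fun degree_coeff :: "matrix_type \<Rightarrow> complex" where
  "degree_coeff Adjacency = 0"
| "degree_coeff Laplacian = 1"
| "degree_coeff Signless_Laplacian = 1"

fun arc_coeff :: "matrix_type \<Rightarrow> complex" where
  "arc_coeff Adjacency = 1"
| "arc_coeff Laplacian = -1"
| "arc_coeff Signless_Laplacian = 1"

text \<open>An entry of the characteristic matrix at a number \<open>x\<close> instead of an
  indeterminate, so that elimination can divide.\<close>

definition char_entry :: "matrix_type \<Rightarrow> 'a pair_pre_digraph \<Rightarrow> complex \<Rightarrow> 'a \<Rightarrow> 'a \<Rightarrow> complex" where
  "char_entry X G x u v =
    (if u = v then x - degree_coeff X * of_nat (out_degree (with_proj G) u) else 0)
    - arc_coeff X * (if (u, v) \<in> parcs G then 1 else 0)"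

lemma graph_matrix_carrier: "graph_matrix vs G X \<in> carrier_mat (length vs) (length vs)"
  by (cases X) (auto simp: adjacency_matrix_def degree_matrix_def)

text \<open>Evaluation at \<open>x\<close> is a ring homomorphism and commutes with the
  determinant.\<close>

lemma poly_char_poly_graph_matrix:
  assumes "distinct vs"
  shows "poly (char_poly (graph_matrix vs G X)) x = det (fmat vs vs (char_entry X G x))"
  unfolding char_poly_def
proof (rule poly_det_cong[where n = "length vs"])
  show "char_poly_matrix (graph_matrix vs G X) \<in> carrier_mat (length vs) (length vs)"
    using graph_matrix_carrier by (rule char_poly_matrix_closed)
  fix i j assume ij: "i < length vs" "j < length vs"
  then show "poly (char_poly_matrix (graph_matrix vs G X) $$ (i, j)) x
      = fmat vs vs (char_entry X G x) $$ (i, j)"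
    unfolding char_poly_matrix_def graph_matrix_conv[OF assms] using assms
    by (cases X) (auto simp: char_entry_def nth_eq_iff_index_eq)
qed simp

text \<open>Characteristic polynomials are monic and split over the complex numbers, so their roots
  with multiplicities determine them.\<close>

lemma char_poly_eq_iff_proots_eq:
  fixes A B :: "complex mat"
  assumes "A \<in> carrier_mat n n" "B \<in> carrier_mat m m"
  shows "char_poly A = char_poly B \<longleftrightarrow> proots (char_poly A) = proots (char_poly B)"
proof
  have "lead_coeff (char_poly A) = 1" "lead_coeff (char_poly B) = 1"
    using degree_monic_char_poly[OF assms(1)] degree_monic_char_poly[OF assms(2)] by auto
  moreover assume "proots (char_poly A) = proots (char_poly B)"
  ultimately show "char_poly A = char_poly B"
    by (metis complex_poly_decompose_multiset)
qed simp

text \<open>By symmetry in-neighbours are out-neighbours, so each column meets \<open>r\<close>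
  arcs. This supplies the constant column sum for the block of \<open>F\<close>.\<close>

lemma col_sum_regular:
  assumes F: "pair_graph F" "regular r F" and fs: "distinct fs" "set fs = pverts F"
    and j: "j < length fs"
  shows "(\<Sum>i = 0..<length fs. (if fs ! i = fs ! j then y else 0)
      - c * (if (fs ! i, fs ! j) \<in> parcs F then 1 else 0)) = y - c * (of_nat r :: complex)"
proof -
  have F': "parcs F \<subseteq> pverts F \<times> pverts F" "sym (parcs F)" "finite (pverts F)"
    using F by (auto simp: pair_graph_iff)
  have jF: "fs ! j \<in> pverts F" using j fs(2) nth_mem by blast
  have "pverts F \<inter> {a. (a, fs ! j) \<in> parcs F} = parcs F `` {fs ! j}"
    using F'(1,2) by (auto dest: symD)
  then have c: "card (pverts F \<inter> {a. (a, fs ! j) \<in> parcs F}) = r"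
    using F(2) jF by (simp add: regular_def out_degree_card)
  have "(\<Sum>i = 0..<length fs. (if fs ! i = fs ! j then y else 0)
      - c * (if (fs ! i, fs ! j) \<in> parcs F then 1 else 0))
    = (\<Sum>a\<in>pverts F. (if a = fs ! j then y else 0) - c * (if (a, fs ! j) \<in> parcs F then 1 else 0))"
    by (rule sum.reindex_bij_betw[OF bij_betw_nth]) (use fs in auto)
  also have "\<dots> = y - c * (\<Sum>a\<in>pverts F. if (a, fs ! j) \<in> parcs F then 1 else 0)"
    using jF F'(3) by (simp add: sum_subtractf sum_distrib_left)
  also have "(\<Sum>a\<in>pverts F. if (a, fs ! j) \<in> parcs F then 1 else 0) = (of_nat r :: complex)"
    using F'(3) c by (simp add: sum.If_cases)
  finally show ?thesis .
qed

section \<open>The characteristic polynomial of a splitting join\<close>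

text \<open>The vertices of \<open>F\<close> come last, as the lower right block to be eliminated.
  The sum type tells the vertices of \<open>G\<close>, which are joined to \<open>F\<close>, from
  their copies, which are not.\<close>

definition splitting_join_enum :: "'a list \<Rightarrow> 'b list \<Rightarrow> ('a, 'b) join_vertex list" where
  "splitting_join_enum gs fs = map (case_sum Fst Copy) (map Inl gs @ map Inr gs) @ map Snd fs"

lemma splitting_join_enum:
  assumes "distinct gs" "set gs = pverts G" "distinct fs" "set fs = pverts F"
  shows "distinct (splitting_join_enum gs fs)"
    "set (splitting_join_enum gs fs) = pverts (splitting_join R G F)"
  using assms by (auto simp: splitting_join_enum_def distinct_map inj_on_def)

text \<open>In the block of \<open>F\<close>, \<open>y\<close> is the diagonal entry and
  \<open>s\<close> the column sum by which the elimination divides. The last factor is the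
  determinant of this block.\<close>

lemma poly_char_poly_splitting_join:
  fixes x :: complex and X :: matrix_type
  assumes G: "pair_graph G" and F: "pair_graph F" "regular r F" and R: "R \<subseteq> pverts G \<times> pverts G"
    and gs: "distinct gs" "set gs = pverts G" and fs: "distinct fs" "set fs = pverts F"
  defines "y \<equiv> x - degree_coeff X * of_nat (r + card (pverts G))"
  defines "s \<equiv> y - arc_coeff X * of_nat r"
  assumes s: "s \<noteq> 0"
  shows "poly (char_poly (graph_matrix (splitting_join_enum gs fs) (splitting_join R G F) X)) x =
    det (fmat (map Inl gs @ map Inr gs) (map Inl gs @ map Inr gs) (\<lambda>a b.
      char_entry X (splitting_join R G F) x (case_sum Fst Copy a) (case_sum Fst Copy b)
        - of_nat (card (pverts F)) / s * (if isl a then - arc_coeff X else 0)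
          * (if isl b then - arc_coeff X else 0)))
    * (arc_coeff X ^ card (pverts F) * poly (char_poly (graph_matrix fs F Adjacency)) (arc_coeff X * y))"
proof -
  let ?J = "splitting_join R G F" and ?c = "case_sum Fst Copy"
  let ?f = "char_entry X ?J x"
  let ?e = "\<lambda>a. if isl a then - arc_coeff X else 0"
  let ?zs = "map Inl gs @ map Inr gs"
  let ?K = "fmat ?zs ?zs (\<lambda>a b. ?f (?c a) (?c b))"
  let ?N = "fmat fs fs (\<lambda>a b. ?f (Snd a) (Snd b))"
  have m: "length fs = card (pverts F)" using fs distinct_card by fastforce
  have mem: "a \<in> pverts F \<longleftrightarrow> a \<in> set fs" "b \<in> pverts G \<longleftrightarrow> b \<in> set gs" for a b using fs gs by auto
  have f: "?f (Snd a) (Snd b) = (if a = b then y else 0) - arc_coeff X * (if (a, b) \<in> parcs F then 1 else 0)"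
    if "a \<in> set fs" for a b
    using degree_splitting_join(2)[OF G F(1) R, of a] F(2) that fs(2)
    by (auto simp: char_entry_def y_def regular_def)
  \<comment> \<open>In these columns a vertex of \<open>G\<close> has only entries
    \<open>- arc_coeff X\<close> and a copy only 0, so the block is constant along rows.\<close>
  have B: "fmat ?zs fs (\<lambda>a b. ?f (?c a) (Snd b)) = mat (length ?zs) (length fs) (\<lambda>(i, j). ?e (?zs ! i))"
    by (rule eq_matI) (auto simp: char_entry_def nth_append mem)
  have D: "fmat fs ?zs (\<lambda>a b. ?f (Snd a) (?c b)) = mat (length fs) (length ?zs) (\<lambda>(i, j). ?e (?zs ! j))"
    by (rule eq_matI) (auto simp: char_entry_def nth_append mem)
  have "poly (char_poly (graph_matrix (splitting_join_enum gs fs) ?J X)) x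
      = det (four_block_mat ?K (mat (length ?zs) (length fs) (\<lambda>(i, j). ?e (?zs ! i)))
          (mat (length fs) (length ?zs) (\<lambda>(i, j). ?e (?zs ! j))) ?N)"
    unfolding poly_char_poly_graph_matrix[OF splitting_join_enum(1)[OF gs fs]]
    unfolding splitting_join_enum_def fmat_append[of "map ?c ?zs"] fmat_map B D ..
  also have "\<dots> = det (mat (length ?zs) (length ?zs)
      (\<lambda>(i, j). ?K $$ (i, j) - of_nat (length fs) / s * ?e (?zs ! i) * ?e (?zs ! j))) * det ?N"
  proof (rule det_four_block_constant_col_sums)
    fix j assume j: "j < length fs"
    have "(\<Sum>i = 0..<length fs. ?N $$ (i, j)) = (\<Sum>i = 0..<length fs. (if fs ! i = fs ! j then y else 0)
      - arc_coeff X * (if (fs ! i, fs ! j) \<in> parcs F then 1 else 0))"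
      by (rule sum.cong) (use j in \<open>auto simp: f\<close>)
    also have "\<dots> = s"
      unfolding s_def by (rule col_sum_regular[OF F fs j])
    finally show "(\<Sum>i = 0..<length fs. ?N $$ (i, j)) = s" .
  qed (use s in auto)
  also have "mat (length ?zs) (length ?zs)
      (\<lambda>(i, j). ?K $$ (i, j) - of_nat (length fs) / s * ?e (?zs ! i) * ?e (?zs ! j))
    = fmat ?zs ?zs (\<lambda>a b. ?f (?c a) (?c b) - of_nat (length fs) / s * ?e a * ?e b)"
    by (rule eq_matI) simp_all
  also have "?N = fmat fs fs (\<lambda>a b. (if a = b then y else 0)
      - arc_coeff X * (if (a, b) \<in> parcs F then 1 else 0))"
    using f by (rule fmat_cong)
  \<comment> \<open>\<open>arc_coeff X\<close> is 1 or -1, hence its own inverse; factoring it out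
    turns \<open>y\<close> on the diagonal into \<open>arc_coeff X * y\<close>.\<close>
  also have "\<dots> = arc_coeff X \<cdot>\<^sub>m fmat fs fs (char_entry Adjacency F (arc_coeff X * y))"
    by (rule eq_matI; cases X) (auto simp: char_entry_def)
  also have "det \<dots> = arc_coeff X ^ length fs * poly (char_poly (graph_matrix fs F Adjacency)) (arc_coeff X * y)"
    unfolding poly_char_poly_graph_matrix[OF fs(1)] by (simp add: det_smult)
  finally show ?thesis unfolding m .
qed

lemma cospectral_splitting_join:
  assumes G: "pair_graph G" and F: "pair_graph F" and H: "pair_graph H"
    and reg: "regular r F" "regular r H" and R: "R \<subseteq> pverts G \<times> pverts G"
    and cos: "cospectral Adjacency F H"
  shows "cospectral X (splitting_join R G F) (splitting_join R G H)"
proof -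
  define gs fs hs where "gs = vertex_enum G" and "fs = vertex_enum F" and "hs = vertex_enum H"
  have gs: "distinct gs" "set gs = pverts G" and fs: "distinct fs" "set fs = pverts F"
    and hs: "distinct hs" "set hs = pverts H"
    using vertex_enum G F H by (auto simp: gs_def fs_def hs_def)
  have len: "length fs = card (pverts F)" "length hs = card (pverts H)"
    using fs hs distinct_card by fastforce+
  have char: "char_poly (graph_matrix fs F Adjacency) = char_poly (graph_matrix hs H Adjacency)"
    using cos char_poly_eq_iff_proots_eq[OF graph_matrix_carrier graph_matrix_carrier]
    unfolding cospectral_def graph_spectrum_def fs_def hs_def by blast
  \<comment> \<open>The order is the degree of the characteristic polynomial.\<close>
  have card: "card (pverts F) = card (pverts H)"
    using degree_monic_char_poly[OF graph_matrix_carrier[of fs F Adjacency]]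
      degree_monic_char_poly[OF graph_matrix_carrier[of hs H Adjacency]]
    unfolding char len[symmetric] by simp
  let ?F = "splitting_join R G F" and ?H = "splitting_join R G H"
  let ?p = "char_poly (graph_matrix (splitting_join_enum gs fs) ?F X)"
  let ?q = "char_poly (graph_matrix (splitting_join_enum gs hs) ?H X)"
  let ?c = "case_sum Fst Copy" and ?c' = "case_sum Fst Copy"
  \<comment> \<open>The vertices of \<open>G\<close> and their copies see the second graph only
    through its order, which enters the degrees in \<open>G\<close>.\<close>
  have entry: "char_entry X ?F x (?c a) (?c b) = char_entry X ?H x (?c' a) (?c' b)"
    if "a \<in> pverts G <+> pverts G" for x a b
    using that degree_splitting_join[OF G F R] degree_splitting_join[OF G H R] card
    by (cases a; cases b) (auto simp: char_entry_def)
  have zs: "a \<in> pverts G <+> pverts G" if "a \<in> set (map Inl gs @ map Inr gs)" for a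
    using that gs by auto
  \<comment> \<open>The value of \<open>x\<close> at which the column sum \<open>s\<close>
    vanishes.\<close>
  define x0 where "x0 = degree_coeff X * of_nat (r + card (pverts G)) + arc_coeff X * of_nat r"
  have "poly ?p x = poly ?q x" if "x \<noteq> x0" for x
  proof -
    have ne: "x - degree_coeff X * of_nat (r + card (pverts G)) - arc_coeff X * of_nat r \<noteq> 0"
      using that by (simp add: x0_def diff_eq_eq add.commute)
    show ?thesis
      unfolding poly_char_poly_splitting_join[OF G F reg(1) R gs fs ne]
        poly_char_poly_splitting_join[OF G H reg(2) R gs hs ne] char card
      by (intro arg_cong2[where f = "(*)"] arg_cong[where f = det] fmat_cong refl)
        (simp only: entry[OF zs])
  qed
  \<comment> \<open>Two polynomials that agree off a single point agree at infinitely many points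
    and are equal.\<close>
  then have sub: "- {x0} \<subseteq> {x. poly (?p - ?q) x = 0}" by auto
  have "infinite (- {x0})" using infinite_UNIV_char_0 by (simp add: Compl_eq_Diff_UNIV)
  then have "infinite {x. poly (?p - ?q) x = 0}" using sub finite_subset by blast
  then have "?p = ?q" using poly_roots_finite[of "?p - ?q"] by auto
  then show ?thesis
    unfolding cospectral_def
      graph_spectrum_enum[OF pair_graph_splitting_join[OF G F R] splitting_join_enum[OF gs fs]]
      graph_spectrum_enum[OF pair_graph_splitting_join[OF G H R] splitting_join_enum[OF gs hs]]
    by simp
qed

theorem corollary4p4:
  fixes F :: "'b pair_pre_digraph" and H :: "'c pair_pre_digraph"
    and G :: "'a pair_pre_digraph" and r :: nat
  assumes "pair_graph F" and "pair_graph H"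
    and "regular r F" and "regular r H"
    and "\<not> graph_iso F H"
    and "cospectral Adjacency F H"
    and "pair_graph G"
  shows "NICS {Adjacency, Signless_Laplacian, Laplacian} (NS_join G F) (NS_join G H)
    \<and> NICS {Adjacency, Signless_Laplacian, Laplacian} (NNS_join G F) (NNS_join G H)"
proof -
  have main: "NICS S (splitting_join R G F) (splitting_join R G H)"
    if "R \<subseteq> pverts G \<times> pverts G" "irrefl R" for S R
    using splitting_join_iso_cancel[OF assms(7,1-4) that] assms(5)
      cospectral_splitting_join[OF assms(7,1-4) that(1) assms(6)]
    unfolding NICS_def by blast
  \<comment> \<open>Both relations are irreflexive: \<open>G\<close> has no loops, and the
    non-neighbour relation excludes the diagonal.\<close>
  show ?thesis
    unfolding NS_join_def NNS_join_def
    by (intro conjI main) (use assms(7) in \<open>auto simp: pair_graph_iff irrefl_def\<close>)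
qed

end
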